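(* Let $n\ge 3$ and let $A=(a_{ij})\in\mathbb{C}^{n\times n}$ be irreducible with $A\in GDE_n$. Then $\rho(H_{BGS})<1$ (i.e., the sequence $\{x^{(i)}\}$ generated by the BGS scheme converges to the unique solution of $Ax=b$ for any choice of the initial guess $x^{(0)}$) if and only if $D_A^{-1}A\notin \mathscr{L}^{\phi}_n$ for every $\phi\in\mathbb{R}$.
   Context: $GDE_n$ is the set of $n\times n$ complex matrices that are generalized diagonally equipotent: there exist positive constants $\alpha_1,\dots,\alpha_n$ with $\alpha_i|a_{ii}|=\sum_{j\ne i}\alpha_j|a_{ij}|$ for all $i$. For $A$ with all $a_{ii}\neq 0$ (automatic for irreducible $A\in GDE_n$, $n\ge 2$), write $A=D_A-L_A-U_A$ with $D_A=\mathrm{diag}(a_{11},\dots,a_{nn})$, $L_A$ strictly lower triangular, $U_A$ strictly upper triangular. The backward Gauss-Seidel (BGS) iteration matrix is $H_{BGS}=(D_A-U_A)^{-1}L_A$, and the BGS scheme for $Ax=b$ is $x^{(i+1)}=H_{BGS}x^{(i)}+(D_A-U_A)^{-1}b$, $i=0,1,2,\dots$. $\rho$ denotes the spectral radius. A matrix $(e^{i\phi_{rs}})\in\mathbb{C}^{n\times n}$ ($\phi_{rs}\in\mathbb{R}$, $i=\sqrt{-1}$) is a $\phi$-ray pattern matrix ($\phi\in\mathbb{R}$) if, modulo $2\pi$: (1) $\phi_{rs}+\phi_{sr}\equiv\phi$ for all $r\ne s$; (2) $\phi_{rs}-\phi_{rt}\equiv\phi_{ts}-\phi+\pi$ whenever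 $r<s<t$ or $s<t<r$ or $t<r<s$; (3) $\phi_{rs}-\phi_{rt}\equiv\phi_{ts}+\pi$ whenever $r<t<s$ or $t<s<r$ or $s<r<t$; (4) $\phi_{rr}=0$ for all $r$. $\mathscr{L}^{\phi}_n$ is the set of $n\times n$ complex matrices $B=(b_{rs})$ for which there exist $\eta\in\mathbb{R}$ and a $\phi$-ray pattern matrix $(e^{i\phi_{rs}})$ with $b_{rs}=e^{i\eta}|b_{rs}|e^{i\phi_{rs}}$ for all $r,s$. *)

theory Defs
  imports
    "HOL-Analysis.Analysis"
    "HOL-Library.Real_Mod"
    "Jordan_Normal_Form.Gauss_Jordan_Elimination"
    "Jordan_Normal_Form.Spectral_Radius"
begin

hide_const (open) Finite_Cartesian_Product.mat Finite_Cartesian_Product.vec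
no_notation Finite_Cartesian_Product.vec_nth (infixl \<open>$\<close> 90)

text \<open>Row and column indices run over \<open>0, \<dots>, n - 1\<close>.\<close>

text \<open>\<open>A\<close> is reducible if some simultaneous permutation of rows and columns, that is
  \<open>P A P\<^sup>T\<close> for a permutation matrix \<open>P\<close>, has a zero lower left block of size
  \<open>(n - k) \<times> k\<close> with \<open>1 \<le> k < n\<close>.\<close>

definition reducible_mat :: "complex mat \<Rightarrow> bool" where
  "reducible_mat A \<longleftrightarrow>
     (\<exists>p k. p permutes {..<dim_row A} \<and> 1 \<le> k \<and> k < dim_row A \<and>
        (\<forall>i j. k \<le> i \<and> i < dim_row A \<and> j < k \<longrightarrow> A $$ (p i, p j) = 0))"

definition irreducible_mat :: "complex mat \<Rightarrow> bool" where
  "irreducible_mat A \<longleftrightarrow> square_mat A \<and> \<not> reducible_mat A"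

definition GDE :: "nat \<Rightarrow> complex mat set" where
  "GDE n = {A \<in> carrier_mat n n. \<exists>\<alpha> :: nat \<Rightarrow> real. (\<forall>i<n. 0 < \<alpha> i) \<and>
     (\<forall>i<n. \<alpha> i * cmod (A $$ (i, i)) = (\<Sum>j\<in>{..<n} - {i}. \<alpha> j * cmod (A $$ (i, j))))}"

text \<open>The splitting \<open>A = D - L - U\<close>; note the signs of \<open>L\<close> and \<open>U\<close>.\<close>

definition D_part :: "complex mat \<Rightarrow> complex mat" where
  "D_part A = mat_diag (dim_row A) (\<lambda>i. A $$ (i, i))"

definition L_part :: "complex mat \<Rightarrow> complex mat" where
  "L_part A = Matrix.mat (dim_row A) (dim_col A) (\<lambda>(i, j). if j < i then - A $$ (i, j) else 0)"

definition U_part :: "complex mat \<Rightarrow> complex mat" where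
  "U_part A = Matrix.mat (dim_row A) (dim_col A) (\<lambda>(i, j). if i < j then - A $$ (i, j) else 0)"

text \<open>The value is unspecified for singular matrices. It is applied below only to \<open>D\<close> and \<open>D - U\<close>,
  which are invertible as soon as \<open>A\<close> has no zero on its diagonal.\<close>

definition mat_inv :: "complex mat \<Rightarrow> complex mat" where
  "mat_inv A = the (mat_inverse A)"

definition H_BGS :: "complex mat \<Rightarrow> complex mat" where
  "H_BGS A = mat_inv (D_part A - U_part A) * L_part A"

primrec BGS_seq :: "complex mat \<Rightarrow> complex Matrix.vec \<Rightarrow> complex Matrix.vec \<Rightarrow> nat \<Rightarrow> complex Matrix.vec" where
  "BGS_seq A b x0 0 = x0"
| "BGS_seq A b x0 (Suc i) =
     H_BGS A *\<^sub>v BGS_seq A b x0 i + mat_inv (D_part A - U_part A) *\<^sub>v b"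

text \<open>\<open>Ax = b\<close> has a unique solution, and the scheme converges to it (entrywise) from every
  initial guess.\<close>

definition BGS_converges :: "nat \<Rightarrow> complex mat \<Rightarrow> complex Matrix.vec \<Rightarrow> bool" where
  "BGS_converges n A b \<longleftrightarrow>
     (\<exists>x\<in>carrier_vec n. A *\<^sub>v x = b \<and> (\<forall>y\<in>carrier_vec n. A *\<^sub>v y = b \<longrightarrow> y = x) \<and>
        (\<forall>x0\<in>carrier_vec n. \<forall>j<n. (\<lambda>i. BGS_seq A b x0 i $ j) \<longlonglongrightarrow> x $ j))"

text \<open>\<open>[x = y] (rmod 2 * pi)\<close> is congruence of real numbers modulo \<open>2\<pi>\<close>.\<close>

definition ray_pattern_mat :: "nat \<Rightarrow> real \<Rightarrow> complex mat \<Rightarrow> bool" where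
  "ray_pattern_mat n \<phi> P \<longleftrightarrow> (\<exists>\<theta> :: nat \<Rightarrow> nat \<Rightarrow> real.
     P = Matrix.mat n n (\<lambda>(r, s). cis (\<theta> r s)) \<and>
     (\<forall>r<n. \<forall>s<n. r \<noteq> s \<longrightarrow> [\<theta> r s + \<theta> s r = \<phi>] (rmod 2 * pi)) \<and>
     (\<forall>r<n. \<forall>s<n. \<forall>t<n. (r < s \<and> s < t) \<or> (s < t \<and> t < r) \<or> (t < r \<and> r < s) \<longrightarrow>
        [\<theta> r s - \<theta> r t = \<theta> t s - \<phi> + pi] (rmod 2 * pi)) \<and>
     (\<forall>r<n. \<forall>s<n. \<forall>t<n. (r < t \<and> t < s) \<or> (t < s \<and> s < r) \<or> (s < r \<and> r < t) \<longrightarrow>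
        [\<theta> r s - \<theta> r t = \<theta> t s + pi] (rmod 2 * pi)) \<and>
     (\<forall>r<n. \<theta> r r = 0))"

definition L_class :: "nat \<Rightarrow> real \<Rightarrow> complex mat set" where
  "L_class n \<phi> = {B \<in> carrier_mat n n. \<exists>(\<eta> :: real) P. ray_pattern_mat n \<phi> P \<and>
     (\<forall>r<n. \<forall>s<n. B $$ (r, s) = cis \<eta> * complex_of_real (cmod (B $$ (r, s))) * P $$ (r, s))}"

end

theory Submission
  imports Defs
begin

text \<open>If \<open>\<mu>\<close> is an eigenvalue of \<open>H\<close> with \<open>\<bar>\<mu>\<bar> \<ge> 1\<close>, then \<open>D - U - \<mu>\<inverse> L\<close> is singular although
  its off-diagonal entries are no larger in modulus than those of \<open>A\<close>. The equality case of
  Taussky's theorem forces \<open>\<bar>\<mu>\<bar> = 1\<close>, a kernel vector with entries of modulus proportional to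
  \<open>\<alpha> i\<close> and phases \<open>\<psi> i\<close>, and equality in every triangle inequality; the last fixes the phases
  of the entries of \<open>D\<inverse> A\<close> as \<open>\<pi> + \<psi> i - \<psi> j\<close>, plus \<open>\<phi> = arg \<mu>\<close> below the diagonal. These are
  exactly the \<open>\<phi>\<close>-ray patterns. Conversely, such phases make \<open>\<alpha> j * cis (\<psi> j)\<close> an
  eigenvector for \<open>cis \<phi>\<close>.\<close>

section \<open>Equality in the triangle inequality, irreducibility, and Taussky's theorem\<close>

text \<open>Rotated by \<open>cnj u\<close>, with \<open>u\<close> the direction of the sum, the
  terms have real parts adding up to the sum of their moduli. No real part exceeds its modulus, so
  every rotated term is real and equal to its modulus. For a zero sum, \<open>sgn\<close> is 0 and
  all terms vanish.\<close>

lemma sum_norm_eq_imp_aligned: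
  fixes z :: "'a \<Rightarrow> complex"
  assumes "finite S" and eq: "cmod (\<Sum>j\<in>S. z j) = (\<Sum>j\<in>S. cmod (z j))" and "j \<in> S"
  shows "z j = of_real (cmod (z j)) * sgn (\<Sum>j\<in>S. z j)"
proof (cases "(\<Sum>j\<in>S. z j) = 0")
  case True
  then have "(\<Sum>j\<in>S. cmod (z j)) = 0" using eq by simp
  then have "z j = 0"
    using sum_nonneg_eq_0_iff[OF \<open>finite S\<close>, of "\<lambda>j. cmod (z j)"] \<open>j \<in> S\<close> by simp
  then show ?thesis by simp
next
  case False
  define w where "w = (\<Sum>j\<in>S. z j)"
  define u where "u = sgn w"
  have w: "w = of_real (cmod w) * u" and u: "cmod u = 1"
    using False by (simp_all add: u_def w_def norm_sgn) (simp add: sgn_eq)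
  have uu: "u * cnj u = 1" using u by (simp add: complex_norm_square[symmetric])
  have le: "Re (cnj u * z k) \<le> cmod (z k)" for k
    using complex_Re_le_cmod[of "cnj u * z k"] u by (simp add: norm_mult)
  have "cnj u * w = of_real (cmod w)"
    by (subst w) (use uu in \<open>simp add: mult.commute mult.left_commute\<close>)
  then have "(\<Sum>k\<in>S. Re (cnj u * z k)) = cmod w"
    by (metis Re_complex_of_real Re_sum sum_distrib_left w_def)
  then have "(\<Sum>k\<in>S. cmod (z k) - Re (cnj u * z k)) = 0"
    using eq by (simp add: sum_subtractf w_def)
  then have re: "Re (cnj u * z j) = cmod (z j)"
    using sum_nonneg_eq_0_iff[OF \<open>finite S\<close>, of "\<lambda>k. cmod (z k) - Re (cnj u * z k)"] le \<open>j \<in> S\<close>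
    by auto
  have "cmod (cnj u * z j) = cmod (z j)" using u by (simp add: norm_mult)
  then have "(Re (cnj u * z j))\<^sup>2 + (Im (cnj u * z j))\<^sup>2 = (cmod (z j))\<^sup>2"
    by (metis cmod_power2)
  then have "Im (cnj u * z j) = 0" unfolding re by simp
  then have "cnj u * z j = of_real (cmod (z j))" using re by (simp add: complex_eq_iff)
  then have "u * cnj u * z j = u * of_real (cmod (z j))" by (simp only: mult.assoc)
  then show ?thesis unfolding uu mult_1 by (simp only: u_def w_def mult.commute)
qed

text \<open>If no nonzero entry led out of \<open>S\<close>, a permutation listing the complement of
  \<open>S\<close> first and \<open>S\<close> last would produce a zero lower left block. This is
  the connectivity form of irreducibility, which the later arguments use.\<close>

lemma irreducible_crossing:
  assumes "irreducible_mat A" "A \<in> carrier_mat n n" "S \<subseteq> {..<n}" "S \<noteq> {}" "S \<noteq> {..<n}"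
  shows "\<exists>i\<in>S. \<exists>j\<in>{..<n} - S. A $$ (i, j) \<noteq> 0"
proof (rule ccontr)
  assume "\<not> ?thesis"
  then have zero: "A $$ (i, j) = 0" if "i \<in> S" "j < n" "j \<notin> S" for i j
    using that by auto
  define T where "T = {..<n} - S"
  define k where "k = card T"
  have fin: "finite S" "finite T" using assms(3) by (auto simp: T_def intro: finite_subset)
  have kn: "k + card S = n"
    using assms(3) card_mono[OF _ assms(3)] fin by (simp add: k_def T_def card_Diff_subset)
  have k: "1 \<le> k" "k < n"
  proof -
    have "T \<noteq> {}" using assms(3,5) by (auto simp: T_def)
    then show "1 \<le> k" using fin by (simp add: k_def Suc_le_eq card_gt_0_iff)
    have "card S > 0" using fin assms(4) by (simp add: card_gt_0_iff)
    then show "k < n" using kn by simp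
  qed
  obtain f where f: "bij_betw f {..<k} T"
    using finite_same_card_bij[of "{..<k}" T] fin by (auto simp: k_def)
  obtain g where g: "bij_betw g {k..<n} S"
    using finite_same_card_bij[of "{k..<n}" S] fin kn by auto
  define p where "p i = (if i < k then f i else if i < n then g i else i)" for i
  have "bij_betw p {..<k} T" using f by (rule bij_betw_cong[THEN iffD1, rotated]) (simp add: p_def)
  moreover have "bij_betw p {k..<n} S"
    using g by (rule bij_betw_cong[THEN iffD1, rotated]) (simp add: p_def)
  ultimately have "bij_betw p ({..<k} \<union> {k..<n}) (T \<union> S)"
    by (rule bij_betw_combine) (auto simp: T_def)
  moreover have "{..<k} \<union> {k..<n} = {..<n}" "T \<union> S = {..<n}"
    using k assms(3) by (auto simp: T_def)
  ultimately have perm: "p permutes {..<n}"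
    using k by (intro bij_imp_permutes) (auto simp: p_def)
  have "A $$ (p i, p j) = 0" if "k \<le> i" "i < n" "j < k" for i j
  proof (rule zero)
    show "p i \<in> S" using that bij_betwE[OF g] by (simp add: p_def)
    have "p j \<in> T" using that bij_betwE[OF f] by (simp add: p_def)
    then show "p j < n" "p j \<notin> S" by (auto simp: T_def)
  qed
  then have "reducible_mat A"
    unfolding reducible_mat_def using perm k assms(2) by (intro exI[of _ p] exI[of _ k]) auto
  then show False using assms(1) by (simp add: irreducible_mat_def)
qed

text \<open>A zero diagonal entry would make the whole row vanish by equipotence, but irreducibility
  provides a nonzero entry leading out of \<open>{i}\<close>.\<close>

lemma irreducible_GDE_diag_nonzero:
  assumes "irreducible_mat A" "A \<in> GDE n" "n \<ge> 2" "i < n"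
  shows "A $$ (i, i) \<noteq> 0"
proof
  assume zero: "A $$ (i, i) = 0"
  obtain \<alpha> :: "nat \<Rightarrow> real" where A: "A \<in> carrier_mat n n" and pos: "\<And>i. i < n \<Longrightarrow> 0 < \<alpha> i"
    and eq: "\<And>i. i < n \<Longrightarrow>
      \<alpha> i * cmod (A $$ (i, i)) = (\<Sum>j\<in>{..<n} - {i}. \<alpha> j * cmod (A $$ (i, j)))"
    using assms(2) unfolding GDE_def by auto
  have "{i} \<noteq> {..<n}"
  proof
    assume "{i} = {..<n}"
    then have "card {i} = card {..<n}" by (rule arg_cong)
    then show False using assms(3) by simp
  qed
  then obtain j where j: "j < n" "j \<noteq> i" "A $$ (i, j) \<noteq> 0"
    using irreducible_crossing[OF assms(1) A, of "{i}"] assms(4) by auto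
  have "0 < \<alpha> j * cmod (A $$ (i, j))" using j pos by simp
  also have "\<dots> \<le> (\<Sum>j\<in>{..<n} - {i}. \<alpha> j * cmod (A $$ (i, j)))"
    using j pos by (intro member_le_sum) (auto intro!: mult_nonneg_nonneg intro: less_imp_le)
  finally show False using eq[OF assms(4)] zero by simp
qed

text \<open>The equality case of Taussky's theorem: the indices where \<open>\<bar>x i\<bar> / \<alpha> i\<close> is maximal form a
  set that no entry leaves.\<close>

lemma GDE_kernel_aligned:
  fixes M :: "nat \<Rightarrow> nat \<Rightarrow> complex"
  assumes irr: "irreducible_mat A" and A: "A \<in> carrier_mat n n"
    and pos: "\<And>i. i < n \<Longrightarrow> 0 < \<alpha> i"
    and eq: "\<And>i. i < n \<Longrightarrow>
      \<alpha> i * cmod (A $$ (i, i)) = (\<Sum>j\<in>{..<n} - {i}. \<alpha> j * cmod (A $$ (i, j)))"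
    and diag: "\<And>i. i < n \<Longrightarrow> M i i = A $$ (i, i)"
    and le: "\<And>i j. i < n \<Longrightarrow> j < n \<Longrightarrow> cmod (M i j) \<le> cmod (A $$ (i, j))"
    and ker: "\<And>i. i < n \<Longrightarrow> (\<Sum>j<n. M i j * x j) = 0"
    and nz: "m < n" "x m \<noteq> 0"
  obtains c where "c > 0" "\<And>i. i < n \<Longrightarrow> cmod (x i) = c * \<alpha> i"
    "\<And>i j. i < n \<Longrightarrow> j < n \<Longrightarrow> cmod (M i j) = cmod (A $$ (i, j))"
    "\<And>i j. i < n \<Longrightarrow> j < n \<Longrightarrow> i \<noteq> j \<Longrightarrow>
       M i j * x j = - of_real (cmod (M i j * x j)) * sgn (A $$ (i, i) * x i)"
proof -
  \<comment> \<open>The largest ratio: \<open>cmod (x i) \<le> c * \<alpha> i\<close> holds for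
    every index, with equality exactly on the set \<open>S\<close> below.\<close>
  define c where "c = Max ((\<lambda>i. cmod (x i) / \<alpha> i) ` {..<n})"
  have c_ge: "cmod (x i) / \<alpha> i \<le> c" if "i < n" for i
    unfolding c_def using that by (intro Max_ge) auto
  have x_le: "cmod (x i) \<le> c * \<alpha> i" if "i < n" for i
    using c_ge[OF that] pos[OF that] by (simp add: field_simps)
  have "0 < cmod (x m) / \<alpha> m" using nz pos by simp
  then have c: "c > 0" using c_ge[OF nz(1)] by linarith
  define S where "S = {i. i < n \<and> cmod (x i) = c * \<alpha> i}"
  have "c \<in> (\<lambda>i. cmod (x i) / \<alpha> i) ` {..<n}"
    unfolding c_def using nz(1) by (intro Max_in) auto
  then obtain i0 where i0: "i0 < n" "c = cmod (x i0) / \<alpha> i0" by auto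
  then have "i0 \<in> S" using pos[OF i0(1)] by (simp add: S_def)
  have offdiag: "(\<Sum>j\<in>{..<n} - {i}. M i j * x j) = - (A $$ (i, i) * x i)" if "i < n" for i
  proof -
    have "(\<Sum>j<n. M i j * x j) = M i i * x i + (\<Sum>j\<in>{..<n} - {i}. M i j * x j)"
      using that by (intro sum.remove) auto
    then show ?thesis using ker[OF that] diag[OF that] by (simp add: eq_neg_iff_add_eq_0 add.commute)
  qed
  have term_le: "cmod (M i j * x j) \<le> cmod (A $$ (i, j)) * (c * \<alpha> j)" if "i < n" "j < n" for i j
    using le[OF that] x_le[OF that(2)] by (simp add: norm_mult mult_mono)
  have total: "(\<Sum>j\<in>{..<n} - {i}. cmod (A $$ (i, j)) * (c * \<alpha> j)) = cmod (A $$ (i, i) * x i)"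
    if "i \<in> S" for i
  proof -
    have "(\<Sum>j\<in>{..<n} - {i}. cmod (A $$ (i, j)) * (c * \<alpha> j))
        = c * (\<Sum>j\<in>{..<n} - {i}. \<alpha> j * cmod (A $$ (i, j)))"
      by (simp add: sum_distrib_left mult_ac)
    then show ?thesis using that eq[of i] by (simp add: S_def norm_mult mult_ac)
  qed
  \<comment> \<open>In a row of \<open>S\<close> the sum is squeezed: termwise domination together
    with equipotence bounds it from above, the triangle inequality in the kernel equation from
    below. Hence every termwise bound in that row is attained (\<open>term_eq\<close>).\<close>
  have sum_norm: "(\<Sum>j\<in>{..<n} - {i}. cmod (M i j * x j)) = cmod (A $$ (i, i) * x i)"
    if "i \<in> S" for i
  proof (rule antisym)
    have i: "i < n" using that by (simp add: S_def)
    have "(\<Sum>j\<in>{..<n} - {i}. cmod (M i j * x j)) \<le> (\<Sum>j\<in>{..<n} - {i}. cmod (A $$ (i, j)) * (c * \<alpha> j))"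
      using i by (intro sum_mono term_le) auto
    then show "(\<Sum>j\<in>{..<n} - {i}. cmod (M i j * x j)) \<le> cmod (A $$ (i, i) * x i)"
      using total[OF that] by simp
    show "cmod (A $$ (i, i) * x i) \<le> (\<Sum>j\<in>{..<n} - {i}. cmod (M i j * x j))"
      using norm_sum[of "\<lambda>j. M i j * x j" "{..<n} - {i}"] offdiag[OF i] by simp
  qed
  have term_eq: "cmod (M i j * x j) = cmod (A $$ (i, j)) * (c * \<alpha> j)"
    if "i \<in> S" "j < n" "j \<noteq> i" for i j
  proof -
    have i: "i < n" using that by (simp add: S_def)
    have "(\<Sum>j\<in>{..<n} - {i}. cmod (A $$ (i, j)) * (c * \<alpha> j) - cmod (M i j * x j)) = 0"
      unfolding sum_subtractf using total[OF that(1)] sum_norm[OF that(1)] by simp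
    then have "\<forall>j\<in>{..<n} - {i}. cmod (A $$ (i, j)) * (c * \<alpha> j) - cmod (M i j * x j) = 0"
      using i term_le by (subst (asm) sum_nonneg_eq_0_iff) (auto simp del: norm_mult)
    then show ?thesis using that by auto
  qed
  \<comment> \<open>A nonzero \<open>A $$ (i, j)\<close> can be cancelled from
    \<open>term_eq\<close>, which leaves the missing bound
    \<open>c * \<alpha> j \<le> cmod (x j)\<close>.\<close>
  have closed: "j \<in> S" if "i \<in> S" "j < n" "A $$ (i, j) \<noteq> 0" for i j
  proof (cases "j = i")
    case False
    have i: "i < n" using that by (simp add: S_def)
    have "cmod (A $$ (i, j)) * (c * \<alpha> j) \<le> cmod (A $$ (i, j)) * cmod (x j)"
      unfolding term_eq[OF that(1,2) False, symmetric] norm_mult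
      using le[OF i that(2)] by (intro mult_right_mono) auto
    then have "c * \<alpha> j \<le> cmod (x j)" using that(3) by simp
    then show ?thesis using x_le[OF that(2)] that(2) by (simp add: S_def)
  qed (use that in simp)
  have S: "S = {..<n}"
  proof (rule ccontr)
    assume "S \<noteq> {..<n}"
    then obtain i j where "i \<in> S" "j < n" "j \<notin> S" "A $$ (i, j) \<noteq> 0"
      using irreducible_crossing[OF irr A, of S] \<open>i0 \<in> S\<close> by (auto simp: S_def)
    then show False using closed by blast
  qed
  have xeq: "cmod (x i) = c * \<alpha> i" if "i < n" for i using S that by (auto simp: S_def)
  have norm_eq: "cmod (M i j) = cmod (A $$ (i, j))" if "i < n" "j < n" for i j
  proof (cases "j = i")
    case False
    have "cmod (M i j) * (c * \<alpha> j) = cmod (A $$ (i, j)) * (c * \<alpha> j)"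
      using term_eq[of i j] S that False xeq by (simp add: norm_mult)
    then show ?thesis using c pos[OF that(2)] by simp
  qed (use diag that in simp)
  have aligned: "M i j * x j = - of_real (cmod (M i j * x j)) * sgn (A $$ (i, i) * x i)"
    if "i < n" "j < n" "i \<noteq> j" for i j
  proof -
    have "i \<in> S" using S that by simp
    have "M i j * x j = of_real (cmod (M i j * x j)) * sgn (\<Sum>j\<in>{..<n} - {i}. M i j * x j)"
    proof (rule sum_norm_eq_imp_aligned)
      show "cmod (\<Sum>j\<in>{..<n} - {i}. M i j * x j) = (\<Sum>j\<in>{..<n} - {i}. cmod (M i j * x j))"
        using sum_norm[OF \<open>i \<in> S\<close>] offdiag[OF that(1)] by simp
    qed (use that in auto)
    then show ?thesis using offdiag[OF that(1)] by (simp add: sgn_minus)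
  qed
  show thesis using that[OF c xeq norm_eq aligned] by blast
qed

section \<open>Matrix inverses, the splitting, and the eigenvalue equation of
  \<open>H_BGS\<close>\<close>

lemma mat_inv_inverts:
  assumes "A \<in> carrier_mat n n" "det A \<noteq> 0"
  shows "mat_inv A \<in> carrier_mat n n" "A * mat_inv A = 1\<^sub>m n" "mat_inv A * A = 1\<^sub>m n"
proof -
  obtain B where B: "mat_inverse A = Some B"
    using mat_inverse(1)[OF assms(1), of "()"] det_non_zero_imp_unit[OF assms, of "()"]
    by (cases "mat_inverse A") auto
  show "mat_inv A \<in> carrier_mat n n" "A * mat_inv A = 1\<^sub>m n" "mat_inv A * A = 1\<^sub>m n"
    using mat_inverse(2)[OF assms(1) B] B by (simp_all add: mat_inv_def)
qed

lemma mat_inv_diag: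
  assumes "A \<in> carrier_mat n n" "\<And>i. i < n \<Longrightarrow> A $$ (i, i) \<noteq> 0"
  shows "mat_inv (D_part A) * A = Matrix.mat n n (\<lambda>(i, j). A $$ (i, j) / A $$ (i, i))"
proof -
  have D: "D_part A \<in> carrier_mat n n" using assms by (simp add: D_part_def)
  have "upper_triangular (D_part A)" using assms by (auto simp: D_part_def mat_diag_def)
  then have "det (D_part A) \<noteq> 0"
    using assms by (subst det_upper_triangular[OF _ D])
      (auto simp: D_part_def prod_list_zero_iff diag_mat_def mat_diag_def)
  note inv = mat_inv_inverts[OF D this]
  let ?E = "mat_diag n (\<lambda>i. 1 / A $$ (i, i))"
  have "D_part A * ?E = mat_diag n (\<lambda>i. A $$ (i, i) * (1 / A $$ (i, i)))"
    using assms(1) by (simp add: D_part_def)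
  also have "\<dots> = 1\<^sub>m n"
    using assms(2) by (intro eq_matI) (auto simp: mat_diag_def)
  finally have "D_part A * ?E = 1\<^sub>m n" .
  then have "mat_inv (D_part A) = mat_inv (D_part A) * (D_part A * ?E)" using inv by simp
  also have "\<dots> = mat_inv (D_part A) * D_part A * ?E"
    using inv(1) D by (intro assoc_mult_mat[of _ n n _ n _ n, symmetric]) auto
  also have "\<dots> = ?E" unfolding inv(3) by (intro left_mult_one_mat[of _ n n]) simp
  finally show ?thesis using assms(1) by (simp add: mat_diag_mult_left)
qed

lemma D_minus_U_carrier:
  assumes "A \<in> carrier_mat n n"
  shows "D_part A - U_part A \<in> carrier_mat n n"
  using assms by (intro minus_carrier_mat) (simp add: U_part_def)

lemma D_minus_U_invertible:
  assumes "A \<in> carrier_mat n n" "\<And>i. i < n \<Longrightarrow> A $$ (i, i) \<noteq> 0"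
  shows "det (D_part A - U_part A) \<noteq> 0"
proof -
  have D: "D_part A - U_part A \<in> carrier_mat n n"
    using assms(1) by (rule D_minus_U_carrier)
  have "upper_triangular (D_part A - U_part A)"
    using assms by (auto simp: D_part_def U_part_def mat_diag_def)
  then show ?thesis
    using assms by (subst det_upper_triangular[OF _ D])
      (auto simp: D_part_def U_part_def prod_list_zero_iff diag_mat_def mat_diag_def)
qed

lemma L_part_carrier: "A \<in> carrier_mat n n \<Longrightarrow> L_part A \<in> carrier_mat n n"
  by (simp add: L_part_def)

lemma splitting:
  assumes "A \<in> carrier_mat n n"
  shows "(D_part A - U_part A) - L_part A = A"
  using assms by (intro eq_matI) (auto simp: D_part_def U_part_def L_part_def mat_diag_def)

lemma H_BGS_carrier:
  assumes "A \<in> carrier_mat n n" "\<And>i. i < n \<Longrightarrow> A $$ (i, i) \<noteq> 0"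
  shows "H_BGS A \<in> carrier_mat n n"
  using mat_inv_inverts(1)[OF D_minus_U_carrier D_minus_U_invertible] assms L_part_carrier
  unfolding H_BGS_def by (metis mult_carrier_mat)

text \<open>Multiplication by the invertible \<open>D - U\<close> removes the inverse hidden in
  \<open>H_BGS\<close>.\<close>

lemma H_BGS_fixed_point_iff:
  assumes A: "A \<in> carrier_mat n n" and diag: "\<And>i. i < n \<Longrightarrow> A $$ (i, i) \<noteq> 0"
    and v: "v \<in> carrier_vec n" and w: "w \<in> carrier_vec n"
  shows "H_BGS A *\<^sub>v v = w \<longleftrightarrow> L_part A *\<^sub>v v = (D_part A - U_part A) *\<^sub>v w"
proof -
  let ?W = "D_part A - U_part A"
  note W = D_minus_U_carrier[OF A] and L = L_part_carrier[OF A]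
  note inv = mat_inv_inverts[OF W D_minus_U_invertible[OF A diag]]
  have H: "H_BGS A *\<^sub>v v = mat_inv ?W *\<^sub>v (L_part A *\<^sub>v v)"
    unfolding H_BGS_def using inv(1) L v by simp
  have "?W *\<^sub>v (mat_inv ?W *\<^sub>v (L_part A *\<^sub>v v)) = L_part A *\<^sub>v v"
    using inv W L v by (subst assoc_mult_mat_vec[symmetric]) auto
  moreover have "mat_inv ?W *\<^sub>v (?W *\<^sub>v w) = w"
    using inv W w by (subst assoc_mult_mat_vec[symmetric]) auto
  ultimately show ?thesis unfolding H by metis
qed

text \<open>These are the rows of \<open>\<mu> (D - U) v - L v = 0\<close>. Since
  \<open>D - U\<close> and \<open>-L\<close> consist of entries of \<open>A\<close> with their own
  signs, the matrix is \<open>A\<close> with the diagonal and upper part scaled by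
  \<open>\<mu>\<close>.\<close>

lemma H_BGS_eigen_iff:
  assumes A: "A \<in> carrier_mat n n" and diag: "\<And>i. i < n \<Longrightarrow> A $$ (i, i) \<noteq> 0"
    and v: "v \<in> carrier_vec n"
  shows "H_BGS A *\<^sub>v v = \<mu> \<cdot>\<^sub>v v \<longleftrightarrow>
    (\<forall>i<n. (\<Sum>j<n. A $$ (i, j) * (if j < i then 1 else \<mu>) * v $ j) = 0)"
proof -
  let ?W = "D_part A - U_part A"
  note W = D_minus_U_carrier[OF A] and L = L_part_carrier[OF A]
  have Lv: "(L_part A *\<^sub>v v) $ i = (\<Sum>j<n. (if j < i then - A $$ (i, j) else 0) * v $ j)"
    if "i < n" for i
    using that A v by (simp add: L_part_def scalar_prod_def lessThan_atLeast0)
  have Wv: "(?W *\<^sub>v (\<mu> \<cdot>\<^sub>v v)) $ i = (\<Sum>j<n. (if j < i then 0 else A $$ (i, j)) * (\<mu> * v $ j))"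
    if "i < n" for i
    using that A v
    by (auto simp: D_part_def U_part_def mat_diag_def scalar_prod_def lessThan_atLeast0 intro!: sum.cong)
  have row: "(\<Sum>j<n. A $$ (i, j) * (if j < i then 1 else \<mu>) * v $ j)
      = (?W *\<^sub>v (\<mu> \<cdot>\<^sub>v v)) $ i - (L_part A *\<^sub>v v) $ i" if "i < n" for i
    unfolding Lv[OF that] Wv[OF that] sum_subtractf[symmetric] by (intro sum.cong) auto
  have "H_BGS A *\<^sub>v v = \<mu> \<cdot>\<^sub>v v \<longleftrightarrow> L_part A *\<^sub>v v = ?W *\<^sub>v (\<mu> \<cdot>\<^sub>v v)"
    using v by (intro H_BGS_fixed_point_iff[OF A diag]) auto
  also have "\<dots> \<longleftrightarrow> (\<forall>i<n. (L_part A *\<^sub>v v) $ i = (?W *\<^sub>v (\<mu> \<cdot>\<^sub>v v)) $ i)"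
    using W L v by (auto intro!: eq_vecI simp del: index_mult_mat_vec)
  finally show ?thesis using row by auto
qed

section \<open>Ray patterns as aligned phases\<close>

text \<open>In this form a ray pattern is the coboundary of its phases \<open>\<psi>\<close>, twisted by \<open>\<phi>\<close> below the
  diagonal.\<close>

definition phase_aligned :: "nat \<Rightarrow> complex mat \<Rightarrow> real \<Rightarrow> (nat \<Rightarrow> real) \<Rightarrow> bool" where
  "phase_aligned n B \<phi> \<psi> \<longleftrightarrow> (\<forall>i<n. \<forall>j<n. i \<noteq> j \<longrightarrow>
     B $$ (i, j) = - of_real (cmod (B $$ (i, j))) * cis ((if j < i then \<phi> else 0) + \<psi> i - \<psi> j))"

text \<open>The unit diagonal makes the global rotation \<open>\<eta>\<close> trivial, and the ray
  conditions express every phase through those of column 0. Conversely, phases of coboundary form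
  satisfy the conditions by direct computation.\<close>

lemma L_class_iff_phase_aligned:
  assumes B: "B \<in> carrier_mat n n" and diag: "\<And>i. i < n \<Longrightarrow> B $$ (i, i) = 1" and n: "n > 0"
  shows "B \<in> L_class n \<phi> \<longleftrightarrow> (\<exists>\<psi>. phase_aligned n B \<phi> \<psi>)"
proof
  assume "\<exists>\<psi>. phase_aligned n B \<phi> \<psi>"
  then obtain \<psi> where \<psi>: "phase_aligned n B \<phi> \<psi>" ..
  \<comment> \<open>The summand \<open>pi\<close> encodes the minus sign of
    \<open>phase_aligned\<close>. In each ray condition the copies of \<open>pi\<close> leave one
    full turn, hence the multiples -1 and 1 below.\<close>
  define \<theta> where
    "\<theta> r s = (if r = s then 0 else pi + (if s < r then \<phi> else 0) + \<psi> r - \<psi> s)" for r s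
  have rc: "[x = y] (rmod 2 * pi)" if "y = x + of_int k * (2 * pi)" for x y k
    using that by (auto simp: rcong_altdef)
  have "[\<theta> r s + \<theta> s r = \<phi>] (rmod 2 * pi)" if "r \<noteq> s" for r s
    by (rule rc[where k = "-1"]) (use that in \<open>auto simp: \<theta>_def\<close>)
  moreover have "[\<theta> r s - \<theta> r t = \<theta> t s - \<phi> + pi] (rmod 2 * pi)"
    if "r < s \<and> s < t \<or> s < t \<and> t < r \<or> t < r \<and> r < s" for r s t
    by (rule rc[where k = 1]) (use that in \<open>auto simp: \<theta>_def\<close>)
  moreover have "[\<theta> r s - \<theta> r t = \<theta> t s + pi] (rmod 2 * pi)"
    if "r < t \<and> t < s \<or> t < s \<and> s < r \<or> s < r \<and> r < t" for r s t
    by (rule rc[where k = 1]) (use that in \<open>auto simp: \<theta>_def\<close>)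
  moreover have "\<theta> r r = 0" for r by (simp add: \<theta>_def)
  ultimately have ray: "ray_pattern_mat n \<phi> (Matrix.mat n n (\<lambda>(r, s). cis (\<theta> r s)))"
    unfolding ray_pattern_mat_def by (intro exI[of _ \<theta>] conjI allI impI) auto
  have entry: "B $$ (r, s) = cis 0 * complex_of_real (cmod (B $$ (r, s)))
      * Matrix.mat n n (\<lambda>(r, s). cis (\<theta> r s)) $$ (r, s)" if "r < n" "s < n" for r s
  proof (cases "r = s")
    case True
    then show ?thesis using diag[OF that(1)] that by (simp add: \<theta>_def)
  next
    case False
    have "cis (\<theta> r s) = - cis ((if s < r then \<phi> else 0) + \<psi> r - \<psi> s)"
      using False by (simp add: \<theta>_def cis_mult[symmetric] add_diff_eq[symmetric] del: cis_mult)
    then show ?thesis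
      using \<psi> that False unfolding phase_aligned_def by simp
  qed
  show "B \<in> L_class n \<phi>"
    unfolding L_class_def using B ray entry by blast
next
  assume "B \<in> L_class n \<phi>"
  then obtain \<eta> P where ray: "ray_pattern_mat n \<phi> P"
    and ent: "\<And>r s. r < n \<Longrightarrow> s < n \<Longrightarrow>
      B $$ (r, s) = cis \<eta> * complex_of_real (cmod (B $$ (r, s))) * P $$ (r, s)"
    unfolding L_class_def by blast
  obtain \<theta> where P: "P = Matrix.mat n n (\<lambda>(r, s). cis (\<theta> r s))"
    and c1: "\<forall>r<n. \<forall>s<n. r \<noteq> s \<longrightarrow> [\<theta> r s + \<theta> s r = \<phi>] (rmod 2 * pi)"
    and c2: "\<forall>r<n. \<forall>s<n. \<forall>t<n. (r < s \<and> s < t) \<or> (s < t \<and> t < r) \<or> (t < r \<and> r < s) \<longrightarrow>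
      [\<theta> r s - \<theta> r t = \<theta> t s - \<phi> + pi] (rmod 2 * pi)"
    and c4: "\<forall>r<n. \<theta> r r = 0"
    using ray unfolding ray_pattern_mat_def by (elim exE conjE) (rule that)
  have \<eta>: "cis \<eta> = 1" using ent[OF n n] diag[OF n] c4 n by (simp add: P)
  \<comment> \<open>Normalized by \<open>\<psi> 0 = 0\<close>, so that
    \<open>\<theta> r 0 = pi + \<phi> + \<psi> r - \<psi> 0\<close> holds exactly for
    \<open>r > 0\<close>.\<close>
  define \<psi> where "\<psi> r = (if r = 0 then 0 else \<theta> r 0 - pi - \<phi>)" for r
  have upper: "[pi + \<psi> i - \<psi> j = \<theta> i j] (rmod 2 * pi)" if ij: "i < j" "j < n" for i j
  proof -
    obtain m :: int where m: "\<phi> = \<theta> j 0 + \<theta> 0 j + of_int m * (2 * pi)"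
      using c1[rule_format, of j 0] ij n by (auto simp: rcong_altdef)
    show ?thesis
    proof (cases "i = 0")
      case True
      then have "\<theta> i j = pi + \<psi> i - \<psi> j + of_int (- m - 1) * (2 * pi)"
        using that m by (simp add: \<psi>_def algebra_simps)
      then show ?thesis unfolding rcong_altdef by blast
    next
      case False
      \<comment> \<open>The triple with \<open>t = 0\<close> expresses \<open>\<theta> i j\<close>
        through \<open>\<theta> i 0\<close> and \<open>\<theta> 0 j\<close>; the relation for
        \<open>m\<close> trades the latter for \<open>\<theta> j 0\<close>.\<close>
      obtain k :: int where k: "\<theta> 0 j - \<phi> + pi = \<theta> i j - \<theta> i 0 + of_int k * (2 * pi)"
        using c2[rule_format, of i j 0] ij n False by (auto simp: rcong_altdef)
      have "\<theta> i j = pi + \<psi> i - \<psi> j + of_int (- m - k) * (2 * pi)"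
        using that m k False by (simp add: \<psi>_def algebra_simps)
      then show ?thesis unfolding rcong_altdef by blast
    qed
  qed
  \<comment> \<open>Condition (1) carries the upper triangle over to the lower one.\<close>
  have lower: "[pi + \<phi> + \<psi> i - \<psi> j = \<theta> i j] (rmod 2 * pi)" if ij: "j < i" "i < n" for i j
  proof -
    obtain k :: int where k: "\<phi> = \<theta> i j + \<theta> j i + of_int k * (2 * pi)"
      using c1[rule_format, of i j] ij by (auto simp: rcong_altdef)
    obtain m :: int where m: "\<theta> j i = pi + \<psi> j - \<psi> i + of_int m * (2 * pi)"
      using upper[OF ij] by (auto simp: rcong_altdef)
    have "\<theta> i j = pi + \<phi> + \<psi> i - \<psi> j + of_int (- k - m - 1) * (2 * pi)"
      using k m by (simp add: algebra_simps)
    then show ?thesis unfolding rcong_altdef by blast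
  qed
  have "cis (\<theta> i j) = - cis ((if j < i then \<phi> else 0) + \<psi> i - \<psi> j)"
    if "i < n" "j < n" "i \<noteq> j" for i j
  proof -
    have "[pi + ((if j < i then \<phi> else 0) + \<psi> i - \<psi> j) = \<theta> i j] (rmod 2 * pi)"
      using upper[of i j] lower[of j i] that by (auto simp: algebra_simps)
    then have "cis (\<theta> i j) = cis (pi + ((if j < i then \<phi> else 0) + \<psi> i - \<psi> j))"
      by (simp add: cis_eq_iff rcong_sym_iff)
    then show ?thesis by (simp add: cis_mult[symmetric] del: cis_mult)
  qed
  moreover have "B $$ (i, j) = of_real (cmod (B $$ (i, j))) * cis (\<theta> i j)" if "i < n" "j < n" for i j
    using ent[OF that] that by (simp add: P \<eta>)
  ultimately have "phase_aligned n B \<phi> \<psi>"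
    unfolding phase_aligned_def by (metis minus_mult_commute)
  then show "\<exists>\<psi>. phase_aligned n B \<phi> \<psi>" by blast
qed

section \<open>Eigenvalues of modulus at least 1 and aligned phases\<close>

lemma H_BGS_eigenvalue_imp_phase_aligned:
  assumes irr: "irreducible_mat A" and gde: "A \<in> GDE n" and n: "n \<ge> 2"
    and ev: "eigenvalue (H_BGS A) \<mu>" and ge: "cmod \<mu> \<ge> 1"
  shows "\<exists>\<psi>. phase_aligned n (Matrix.mat n n (\<lambda>(i, j). A $$ (i, j) / A $$ (i, i))) (Arg \<mu>) \<psi>"
proof -
  obtain \<alpha> :: "nat \<Rightarrow> real" where A: "A \<in> carrier_mat n n" and pos: "\<And>i. i < n \<Longrightarrow> 0 < \<alpha> i"
    and eq: "\<And>i. i < n \<Longrightarrow>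
      \<alpha> i * cmod (A $$ (i, i)) = (\<Sum>j\<in>{..<n} - {i}. \<alpha> j * cmod (A $$ (i, j)))"
    using gde unfolding GDE_def by auto
  note diag = irreducible_GDE_diag_nonzero[OF irr gde n]
  have \<mu>: "\<mu> \<noteq> 0" using ge by auto
  obtain v where v: "v \<in> carrier_vec n" "v \<noteq> 0\<^sub>v n" "H_BGS A *\<^sub>v v = \<mu> \<cdot>\<^sub>v v"
    using ev H_BGS_carrier[OF A diag] unfolding eigenvalue_def eigenvector_def by auto
  obtain m where m: "m < n" "v $ m \<noteq> 0"
    using v(1,2) by (metis carrier_vecD eq_vecI index_zero_vec)
  \<comment> \<open>Dividing the eigenvalue equation by \<open>\<mu>\<close> leaves the diagonal and
    upper entries of \<open>A\<close> unchanged and shrinks the lower ones weakly, as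
    \<open>GDE_kernel_aligned\<close> requires.\<close>
  define f where "f i j = (if j < i then 1 / \<mu> else 1)" for i j :: nat
  have f_le: "cmod (f i j) \<le> 1" for i j
    using ge by (simp add: f_def norm_divide divide_le_eq)
  have ker: "(\<Sum>j<n. A $$ (i, j) * f i j * v $ j) = 0" if "i < n" for i
  proof -
    have "(\<Sum>j<n. A $$ (i, j) * f i j * v $ j)
        = (\<Sum>j<n. A $$ (i, j) * (if j < i then 1 else \<mu>) * v $ j) / \<mu>"
      unfolding sum_divide_distrib using \<mu> by (intro sum.cong) (auto simp: f_def)
    then show ?thesis using H_BGS_eigen_iff[OF A diag v(1), of \<mu>] v(3) that by simp
  qed
  obtain c where c: "c > 0" and vnorm: "\<And>i. i < n \<Longrightarrow> cmod (v $ i) = c * \<alpha> i"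
    and fnorm: "\<And>i j. i < n \<Longrightarrow> j < n \<Longrightarrow> cmod (A $$ (i, j) * f i j) = cmod (A $$ (i, j))"
    and al: "\<And>i j. i < n \<Longrightarrow> j < n \<Longrightarrow> i \<noteq> j \<Longrightarrow> A $$ (i, j) * f i j * v $ j
        = - of_real (cmod (A $$ (i, j) * f i j * v $ j)) * sgn (A $$ (i, i) * v $ i)"
  proof (rule GDE_kernel_aligned[OF irr A pos eq, of "\<lambda>i j. A $$ (i, j) * f i j" "\<lambda>j. v $ j" m])
    show "cmod (A $$ (i, j) * f i j) \<le> cmod (A $$ (i, j))" for i j
      using f_le[of i j] by (simp add: norm_mult mult_left_le)
  qed (use ker m in \<open>auto simp: f_def\<close>)
  have "cmod \<mu> = 1"
  proof -
    \<comment> \<open>All off-diagonal entries of the last row lie below the diagonal. One of them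
      is nonzero and carries the factor \<open>1 / \<mu>\<close>, so preservation of its modulus
      forces \<open>cmod \<mu> = 1\<close>.\<close>
    have "{n - 1} \<noteq> {..<n}"
    proof
      assume "{n - 1} = {..<n}"
      then have "card {n - 1} = card {..<n}" by (rule arg_cong)
      then show False using n by simp
    qed
    then obtain j where j: "j < n" "j \<noteq> n - 1" "A $$ (n - 1, j) \<noteq> 0"
      using irreducible_crossing[OF irr A, of "{n - 1}"] n by auto
    then have "cmod (f (n - 1) j) = 1" using fnorm[of "n - 1" j] n by (simp add: norm_mult)
    moreover have "j < n - 1" using j by simp
    ultimately show ?thesis using \<mu> by (simp add: f_def norm_divide)
  qed
  then have cis_\<mu>: "cis (Arg \<mu>) = \<mu>" using \<mu> by (simp add: cis_Arg sgn_eq)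
  define \<psi> where "\<psi> i = Arg (v $ i)" for i
  have vi: "v $ i = of_real (cmod (v $ i)) * cis (\<psi> i)" for i
    using rcis_cmod_Arg[of "v $ i"] by (simp add: rcis_def \<psi>_def)
  have vpos: "cmod (v $ i) > 0" if "i < n" for i using vnorm[OF that] c pos[OF that] by simp
  have "A $$ (i, j) / A $$ (i, i) = - of_real (cmod (A $$ (i, j) / A $$ (i, i)))
      * cis ((if j < i then Arg \<mu> else 0) + \<psi> i - \<psi> j)" if "i < n" "j < n" "i \<noteq> j" for i j
  proof -
    let ?a = "cmod (A $$ (i, j))" and ?d = "cmod (A $$ (i, i))" and ?y = "cmod (v $ j)"
    have "sgn (v $ i) = cis (\<psi> i)" using vpos[OF that(1)] by (simp add: \<psi>_def cis_Arg)
    then have "A $$ (i, j) * f i j * (of_real ?y * cis (\<psi> j))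
        = - of_real (?a * ?y) * (A $$ (i, i) / of_real ?d * cis (\<psi> i))"
      using al[OF that] fnorm[OF that(1,2)]
      by (simp add: vi[of j, symmetric] norm_mult sgn_mult) (simp add: sgn_eq)
    then have "of_real ?y * (A $$ (i, j) * f i j * cis (\<psi> j))
        = of_real ?y * (- of_real ?a * (A $$ (i, i) / of_real ?d * cis (\<psi> i)))"
      by (simp add: mult_ac)
    then have e: "A $$ (i, j) * f i j * cis (\<psi> j)
        = - of_real ?a * (A $$ (i, i) / of_real ?d * cis (\<psi> i))"
      using vpos[OF that(2)] by (simp only: mult_cancel_left) auto
    have g: "f i j * cis (if j < i then Arg \<mu> else 0) = 1"
      using \<mu> cis_\<mu> by (simp add: f_def)
    have h: "cis (\<psi> j) * cis (- \<psi> j) = 1" by (simp add: cis_mult)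
    \<comment> \<open>Solving \<open>e\<close> for the entry: by \<open>g\<close> and
      \<open>h\<close> the two \<open>cis\<close> factors are the inverses of \<open>f i j\<close>
      and \<open>cis (\<psi> j)\<close>.\<close>
    have "A $$ (i, j) = (A $$ (i, j) * f i j * cis (\<psi> j))
        * (cis (if j < i then Arg \<mu> else 0) * cis (- \<psi> j))"
      using arg_cong2[OF g h, of "\<lambda>x y. A $$ (i, j) * (x * y)"] by (simp only: mult_ac mult_1 mult_1_right)
    also have "\<dots> = - of_real ?a * (A $$ (i, i) / of_real ?d * cis (\<psi> i))
        * (cis (if j < i then Arg \<mu> else 0) * cis (- \<psi> j))"
      unfolding e ..
    finally show ?thesis
      using diag[OF that(1)]
      by (simp add: norm_divide cis_mult divide_simps) (simp add: mult_ac algebra_simps)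
  qed
  then show ?thesis unfolding phase_aligned_def by (intro exI[of _ \<psi>]) simp
qed

text \<open>For the vector \<open>\<alpha> j * cis (\<psi> j)\<close>, the off-diagonal terms of a
  row of the eigenvalue equation share one phase. Their moduli therefore add, and equipotence makes
  the total cancel the diagonal term.\<close>

lemma phase_aligned_imp_H_BGS_eigenvalue:
  assumes gde: "A \<in> GDE n" and diag: "\<And>i. i < n \<Longrightarrow> A $$ (i, i) \<noteq> 0" and n: "n > 0"
    and al: "phase_aligned n (Matrix.mat n n (\<lambda>(i, j). A $$ (i, j) / A $$ (i, i))) \<phi> \<psi>"
  shows "eigenvalue (H_BGS A) (cis \<phi>)"
proof -
  obtain \<alpha> :: "nat \<Rightarrow> real" where A: "A \<in> carrier_mat n n" and pos: "\<And>i. i < n \<Longrightarrow> 0 < \<alpha> i"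
    and eq: "\<And>i. i < n \<Longrightarrow>
      \<alpha> i * cmod (A $$ (i, i)) = (\<Sum>j\<in>{..<n} - {i}. \<alpha> j * cmod (A $$ (i, j)))"
    using gde unfolding GDE_def by auto
  define v where "v = Matrix.vec n (\<lambda>j. of_real (\<alpha> j) * cis (\<psi> j))"
  have v: "v \<in> carrier_vec n" by (simp add: v_def)
  have "v $ 0 \<noteq> 0" using pos[OF n] n by (simp add: v_def)
  then have v0: "v \<noteq> 0\<^sub>v n" using n by auto
  have "(\<Sum>j<n. A $$ (i, j) * (if j < i then 1 else cis \<phi>) * v $ j) = 0" if i: "i < n" for i
  proof -
    \<comment> \<open>The common factor of the off-diagonal terms of row \<open>i\<close>,
      independent of \<open>j\<close>.\<close>
    let ?K = "- (cis \<phi> * cis (\<psi> i) * A $$ (i, i) / of_real (cmod (A $$ (i, i))))"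
    have off: "A $$ (i, j) * (if j < i then 1 else cis \<phi>) * v $ j
        = ?K * of_real (\<alpha> j * cmod (A $$ (i, j)))" if "j \<in> {..<n} - {i}" for j
    proof -
      have j: "j < n" "i \<noteq> j" using that by auto
      have "A $$ (i, j) / A $$ (i, i) = - of_real (cmod (A $$ (i, j) / A $$ (i, i)))
          * cis ((if j < i then \<phi> else 0) + \<psi> i - \<psi> j)"
        using al i j unfolding phase_aligned_def by simp
      then have e: "A $$ (i, j) = - A $$ (i, i) * of_real (cmod (A $$ (i, j)) / cmod (A $$ (i, i)))
          * cis ((if j < i then \<phi> else 0) + \<psi> i - \<psi> j)"
        using diag[OF i] by (simp add: norm_divide divide_simps)
      \<comment> \<open>The factor \<open>cis \<phi>\<close> comes from the entry itself below the
        diagonal and from the eigenvalue above it, so it occurs exactly once either way.\<close>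
      have ph: "cis ((if j < i then \<phi> else 0) + \<psi> i - \<psi> j) * (if j < i then 1 else cis \<phi>) * cis (\<psi> j)
          = cis \<phi> * cis (\<psi> i)"
        by (auto simp: cis_mult add_ac)
      have "A $$ (i, j) * (if j < i then 1 else cis \<phi>) * v $ j
          = - A $$ (i, i) * of_real (cmod (A $$ (i, j)) / cmod (A $$ (i, i))) * of_real (\<alpha> j)
            * (cis ((if j < i then \<phi> else 0) + \<psi> i - \<psi> j) * (if j < i then 1 else cis \<phi>) * cis (\<psi> j))"
        by (subst e) (use j in \<open>simp add: v_def mult_ac\<close>)
      also have "\<dots> = ?K * of_real (\<alpha> j * cmod (A $$ (i, j)))"
        unfolding ph by (simp add: mult_ac)
      finally show ?thesis .
    qed
    have "(\<Sum>j<n. A $$ (i, j) * (if j < i then 1 else cis \<phi>) * v $ j)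
        = A $$ (i, i) * cis \<phi> * v $ i
          + (\<Sum>j\<in>{..<n} - {i}. A $$ (i, j) * (if j < i then 1 else cis \<phi>) * v $ j)"
      using i by (subst sum.remove[of _ i]) auto
    also have "(\<Sum>j\<in>{..<n} - {i}. A $$ (i, j) * (if j < i then 1 else cis \<phi>) * v $ j)
        = (\<Sum>j\<in>{..<n} - {i}. ?K * of_real (\<alpha> j * cmod (A $$ (i, j))))"
      by (intro sum.cong refl off)
    also have "\<dots> = ?K * of_real (\<alpha> i * cmod (A $$ (i, i)))"
      unfolding sum_distrib_left[symmetric] of_real_sum[symmetric] eq[OF i] ..
    also have "\<dots> = - (A $$ (i, i) * cis \<phi> * v $ i)"
      using diag[OF i] i by (simp add: v_def mult_ac)
    finally show ?thesis by simp
  qed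
  then have "H_BGS A *\<^sub>v v = cis \<phi> \<cdot>\<^sub>v v" using H_BGS_eigen_iff[OF A diag v] by simp
  then show ?thesis
    using v v0 H_BGS_carrier[OF A diag] unfolding eigenvalue_def eigenvector_def by auto
qed

section \<open>Spectral radius and convergence of the iteration\<close>

lemma spectral_radius_less_1_iff:
  assumes "A \<in> carrier_mat n n" "n > 0"
  shows "spectral_radius A < 1 \<longleftrightarrow> (\<forall>\<mu>. eigenvalue A \<mu> \<longrightarrow> cmod \<mu> < 1)"
  using spectral_radius_mem_max[OF assms] unfolding spectrum_def by force

lemma smult_pow_mat:
  fixes A :: "'a :: comm_ring_1 mat"
  assumes A: "A \<in> carrier_mat n n"
  shows "(c \<cdot>\<^sub>m A) ^\<^sub>m k = c ^ k \<cdot>\<^sub>m (A ^\<^sub>m k)"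
proof (induction k)
  case 0
  then show ?case using A by (intro eq_matI) auto
next
  case (Suc k)
  then show ?case using A pow_carrier_mat[OF A, of k]
    by (intro eq_matI) (auto simp: mult_smult_assoc_mat mult_smult_distrib mult_ac)
qed

text \<open>With \<open>r\<close> strictly between the spectral radius and 1, the matrix
  \<open>A / r\<close> still has spectral radius below 1, so its powers are uniformly bounded.
  Scaling back gives decay of order \<open>r ^ k\<close>.\<close>

lemma pow_mat_tendsto_0:
  assumes A: "A \<in> carrier_mat n n" and n: "n > 0" and sr: "spectral_radius A < 1"
    and ij: "i < n" "j < n"
  shows "(\<lambda>k. (A ^\<^sub>m k) $$ (i, j)) \<longlonglongrightarrow> 0"
proof -
  define r where "r = (1 + spectral_radius A) / 2"
  have "spectral_radius A \<ge> 0" using spectral_radius_mem_max(1)[OF A n] by auto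
  then have r: "0 < r" "r < 1" "spectral_radius A < r" using sr by (auto simp: r_def)
  define B where "B = (1 / complex_of_real r) \<cdot>\<^sub>m A"
  have B: "B \<in> carrier_mat n n" using A by (simp add: B_def)
  have AB: "A = complex_of_real r \<cdot>\<^sub>m B"
    using r by (intro eq_matI) (auto simp: B_def)
  have "cmod \<mu> < 1" if ev: "eigenvalue B \<mu>" for \<mu>
  proof -
    obtain v where v: "v \<in> carrier_vec n" "v \<noteq> 0\<^sub>v n" "B *\<^sub>v v = \<mu> \<cdot>\<^sub>v v"
      using ev B unfolding eigenvalue_def eigenvector_def by auto
    have "A *\<^sub>v v = (of_real r * \<mu>) \<cdot>\<^sub>v v"
    proof -
      have "(of_real r \<cdot>\<^sub>m B) *\<^sub>v v = of_real r \<cdot>\<^sub>v (B *\<^sub>v v)"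
        using v(1) B by (intro eq_vecI) auto
      then show ?thesis unfolding AB[symmetric] v(3) by (simp add: smult_smult_assoc)
    qed
    then have "eigenvalue A (of_real r * \<mu>)"
      using v A unfolding eigenvalue_def eigenvector_def by auto
    then have "cmod (of_real r * \<mu>) \<le> spectral_radius A"
      using spectral_radius_mem_max(2)[OF A n] by (auto simp: spectrum_def)
    then have "r * cmod \<mu> \<le> spectral_radius A" using r by (simp add: norm_mult)
    then have "r * cmod \<mu> < r * 1" using r by linarith
    then show ?thesis using r(1) by (simp only: mult_less_cancel_left_pos)
  qed
  then have "spectral_radius B < 1" using spectral_radius_less_1_iff[OF B n] by simp
  then obtain c where c: "\<And>k. norm_bound (B ^\<^sub>m k) c"
    using spectral_radius_jnf_norm_bound_less_1_upper_triangular[OF B] by blast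
  have bound: "cmod ((A ^\<^sub>m k) $$ (i, j)) \<le> r ^ k * c" for k
  proof -
    have Bk: "B ^\<^sub>m k \<in> carrier_mat n n" using B by (rule pow_carrier_mat)
    then have "cmod ((B ^\<^sub>m k) $$ (i, j)) \<le> c"
      using c[of k] ij B unfolding norm_bound_def by auto
    moreover have "(A ^\<^sub>m k) $$ (i, j) = of_real r ^ k * (B ^\<^sub>m k) $$ (i, j)"
      unfolding AB smult_pow_mat[OF B] using B Bk ij by simp
    ultimately show ?thesis using r by (simp add: norm_mult norm_power)
  qed
  have "(\<lambda>k. r ^ k * c) \<longlonglongrightarrow> 0 * c"
    using r by (intro tendsto_mult LIMSEQ_power_zero tendsto_const) simp
  then have "(\<lambda>k. r ^ k * c) \<longlonglongrightarrow> 0" by simp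
  then show ?thesis by (rule Lim_null_comparison[rotated]) (use bound in auto)
qed

lemma mult_pow_mat_commute:
  fixes A :: "'a :: semiring_1 mat"
  assumes A: "A \<in> carrier_mat n n"
  shows "A * A ^\<^sub>m k = A ^\<^sub>m k * A"
proof (induction k)
  case 0
  then show ?case using A by simp
next
  case (Suc k)
  have "A * (A ^\<^sub>m k * A) = A * A ^\<^sub>m k * A"
    using A pow_carrier_mat[OF A, of k] by (simp add: assoc_mult_mat[of _ n n _ n _ n])
  then show ?case using Suc by simp
qed

text \<open>Any solution \<open>x\<close> of the system is a fixed point of the affine iteration, so
  each step multiplies the error by \<open>H_BGS A\<close>.\<close>

lemma BGS_seq_error:
  assumes A: "A \<in> carrier_mat n n" and diag: "\<And>i. i < n \<Longrightarrow> A $$ (i, i) \<noteq> 0"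
    and x: "x \<in> carrier_vec n" and b: "b = A *\<^sub>v x" and x0: "x0 \<in> carrier_vec n"
  shows "BGS_seq A b x0 k = H_BGS A ^\<^sub>m k *\<^sub>v (x0 - x) + x"
proof (induction k)
  case 0
  have "H_BGS A \<in> carrier_mat n n" by (rule H_BGS_carrier[OF A diag])
  then show ?case using x x0 by (auto intro!: eq_vecI)
next
  case (Suc k)
  let ?W = "D_part A - U_part A" and ?H = "H_BGS A"
  note W = D_minus_U_carrier[OF A] and L = L_part_carrier[OF A] and H = H_BGS_carrier[OF A diag]
  note inv = mat_inv_inverts[OF W D_minus_U_invertible[OF A diag]]
  have Hk: "?H ^\<^sub>m k \<in> carrier_mat n n" using H by (rule pow_carrier_mat)
  have d: "x0 - x \<in> carrier_vec n" using x x0 by simp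
  have e: "?H ^\<^sub>m k *\<^sub>v (x0 - x) \<in> carrier_vec n" using Hk d by simp
  have "b = ?W *\<^sub>v x - L_part A *\<^sub>v x"
    unfolding b by (subst splitting[OF A, symmetric]) (rule minus_mult_distrib_mat_vec[OF W L x])
  then have "mat_inv ?W *\<^sub>v b = mat_inv ?W *\<^sub>v (?W *\<^sub>v x) - mat_inv ?W *\<^sub>v (L_part A *\<^sub>v x)"
    using inv(1) W L x by (simp add: mult_minus_distrib_mat_vec[of _ n n])
  also have "mat_inv ?W *\<^sub>v (?W *\<^sub>v x) = x"
    using inv W x by (subst assoc_mult_mat_vec[symmetric]) auto
  also have "mat_inv ?W *\<^sub>v (L_part A *\<^sub>v x) = ?H *\<^sub>v x"
    unfolding H_BGS_def using inv(1) L x by simp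
  finally have fixed: "mat_inv ?W *\<^sub>v b = x - ?H *\<^sub>v x" .
  have "BGS_seq A b x0 (Suc k)
      = ?H *\<^sub>v (?H ^\<^sub>m k *\<^sub>v (x0 - x)) + ?H *\<^sub>v x + (x - ?H *\<^sub>v x)"
    using Suc.IH fixed by (simp add: mult_add_distrib_mat_vec[OF H e x])
  also have "?H *\<^sub>v (?H ^\<^sub>m k *\<^sub>v (x0 - x)) = (?H * ?H ^\<^sub>m k) *\<^sub>v (x0 - x)"
    by (rule assoc_mult_mat_vec[symmetric, OF H Hk d])
  \<comment> \<open>The recursion multiplies by \<open>?H\<close> on the left, whereas the matrix
    power unfolds on the right.\<close>
  also have "?H * ?H ^\<^sub>m k = ?H ^\<^sub>m Suc k"
    using mult_pow_mat_commute[OF H] by simp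
  finally show ?case using H x by (auto intro!: eq_vecI simp del: index_mult_mat_vec)
qed

lemma spectral_radius_less_1_iff_BGS_converges:
  assumes A: "A \<in> carrier_mat n n" and diag: "\<And>i. i < n \<Longrightarrow> A $$ (i, i) \<noteq> 0" and n: "n > 0"
    and b: "b \<in> carrier_vec n"
  shows "spectral_radius (H_BGS A) < 1 \<longleftrightarrow> BGS_converges n A b"
proof
  let ?H = "H_BGS A"
  note H = H_BGS_carrier[OF A diag]
  assume sr: "spectral_radius ?H < 1"
  \<comment> \<open>A kernel vector of \<open>A\<close> would be an eigenvector of \<open>?H\<close>
    for the eigenvalue 1: this is the case \<open>\<mu> = 1\<close> of
    \<open>H_BGS_eigen_iff\<close>.\<close>
  have "det A \<noteq> 0"
  proof
    assume "det A = 0"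
    then obtain v where v: "v \<in> carrier_vec n" "v \<noteq> 0\<^sub>v n" "A *\<^sub>v v = 0\<^sub>v n"
      using det_0_iff_vec_prod_zero[OF A] by auto
    have "(\<Sum>j<n. A $$ (i, j) * (if j < i then 1 else 1) * v $ j) = 0" if "i < n" for i
    proof -
      have "(A *\<^sub>v v) $ i = 0" using v(3) that by simp
      then show ?thesis using that A v(1) by (simp add: scalar_prod_def lessThan_atLeast0)
    qed
    then have "?H *\<^sub>v v = 1 \<cdot>\<^sub>v v" by (subst H_BGS_eigen_iff[OF A diag v(1)]) auto
    then have "eigenvalue ?H 1"
      using v H unfolding eigenvalue_def eigenvector_def by auto
    then show False using sr spectral_radius_less_1_iff[OF H n] by force
  qed
  note inv = mat_inv_inverts[OF A this]
  define x where "x = mat_inv A *\<^sub>v b"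
  have x: "x \<in> carrier_vec n" using inv(1) b by (simp add: x_def)
  have Ax: "A *\<^sub>v x = b"
    unfolding x_def using inv A b by (subst assoc_mult_mat_vec[symmetric]) auto
  have uniq: "y = x" if "y \<in> carrier_vec n" "A *\<^sub>v y = b" for y
    unfolding x_def that(2)[symmetric] using inv A that(1)
    by (subst assoc_mult_mat_vec[symmetric]) auto
  have "(\<lambda>k. BGS_seq A b x0 k $ j) \<longlonglongrightarrow> x $ j" if x0: "x0 \<in> carrier_vec n" and j: "j < n" for x0 j
  proof -
    have Hk: "?H ^\<^sub>m k \<in> carrier_mat n n" for k using H by (rule pow_carrier_mat)
    have "BGS_seq A b x0 k = ?H ^\<^sub>m k *\<^sub>v (x0 - x) + x" for k
      by (rule BGS_seq_error[OF A diag x Ax[symmetric] x0])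
    then have "(\<lambda>k. BGS_seq A b x0 k $ j)
        = (\<lambda>k. (\<Sum>l<n. (?H ^\<^sub>m k) $$ (j, l) * (x0 - x) $ l) + x $ j)"
      using H Hk x x0 j by (auto simp: scalar_prod_def lessThan_atLeast0 fun_eq_iff)
    moreover have "(\<lambda>k. (\<Sum>l<n. (?H ^\<^sub>m k) $$ (j, l) * (x0 - x) $ l) + x $ j)
        \<longlonglongrightarrow> (\<Sum>l<n. 0 * (x0 - x) $ l) + x $ j"
      by (intro tendsto_add tendsto_sum tendsto_mult tendsto_const pow_mat_tendsto_0[OF H n sr j]) auto
    ultimately show ?thesis by simp
  qed
  then show "BGS_converges n A b"
    unfolding BGS_converges_def using x Ax uniq by blast
next
  let ?H = "H_BGS A"
  note H = H_BGS_carrier[OF A diag]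
  assume "BGS_converges n A b"
  then obtain x where x: "x \<in> carrier_vec n" and Ax: "A *\<^sub>v x = b"
    and lim: "\<And>x0 j. x0 \<in> carrier_vec n \<Longrightarrow> j < n \<Longrightarrow> (\<lambda>k. BGS_seq A b x0 k $ j) \<longlonglongrightarrow> x $ j"
    unfolding BGS_converges_def by blast
  have "cmod \<mu> < 1" if ev: "eigenvalue ?H \<mu>" for \<mu>
  proof (rule ccontr)
    assume "\<not> cmod \<mu> < 1"
    obtain v where v: "eigenvector ?H v \<mu>" using ev unfolding eigenvalue_def by blast
    then have vc: "v \<in> carrier_vec n" "v \<noteq> 0\<^sub>v n" using H unfolding eigenvector_def by auto
    obtain j where j: "j < n" "v $ j \<noteq> 0"
      using vc by (metis carrier_vecD eq_vecI index_zero_vec)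
    \<comment> \<open>Started at \<open>x + v\<close> with an eigenvector \<open>v\<close>, the
      error after \<open>k\<close> steps is exactly \<open>\<mu> ^ k\<close> times \<open>v\<close>;
      its nonzero component \<open>j\<close> cannot tend to 0 when
      \<open>cmod \<mu> \<ge> 1\<close>.\<close>
    have xv: "x + v \<in> carrier_vec n" using x vc by simp
    have "x + v - x = v" using x vc by (auto intro!: eq_vecI)
    then have seq: "BGS_seq A b (x + v) k $ j = \<mu> ^ k * v $ j + x $ j" for k
      using BGS_seq_error[OF A diag x Ax[symmetric] xv, of k] eigenvector_pow[OF H v, of k] x vc j
      by simp
    have "(\<lambda>k. (\<mu> ^ k * v $ j + x $ j) - x $ j) \<longlonglongrightarrow> x $ j - x $ j"
      using lim[OF xv j(1)] unfolding seq by (intro tendsto_diff tendsto_const)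
    then have "(\<lambda>k. cmod (\<mu> ^ k * v $ j)) \<longlonglongrightarrow> 0"
      using tendsto_norm_zero by fastforce
    moreover have "cmod (v $ j) \<le> cmod (\<mu> ^ k * v $ j)" for k
      using one_le_power[of "cmod \<mu>" k] \<open>\<not> cmod \<mu> < 1\<close>
      by (simp add: norm_mult norm_power mult_le_cancel_right1)
    ultimately have "cmod (v $ j) \<le> 0" by (intro LIMSEQ_le_const) auto
    then show False using j by simp
  qed
  then show "spectral_radius ?H < 1" using spectral_radius_less_1_iff[OF H n] by simp
qed

theorem theorem4p12:
  fixes n :: nat and A :: "complex mat"
  assumes "n \<ge> 3"
    and "A \<in> carrier_mat n n"
    and "irreducible_mat A"
    and "A \<in> GDE n"
  shows "(spectral_radius (H_BGS A) < 1 \<longleftrightarrow>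
            (\<forall>\<phi> :: real. mat_inv (D_part A) * A \<notin> L_class n \<phi>)) \<and>
         (\<forall>b \<in> carrier_vec n. spectral_radius (H_BGS A) < 1 \<longleftrightarrow> BGS_converges n A b)"
proof -
  have n: "n \<ge> 2" "n > 0" using assms(1) by auto
  note diag = irreducible_GDE_diag_nonzero[OF assms(3,4) n(1)]
  have H: "H_BGS A \<in> carrier_mat n n"
    by (rule H_BGS_carrier[OF assms(2) diag])
  let ?B = "Matrix.mat n n (\<lambda>(i, j). A $$ (i, j) / A $$ (i, i))"
  have normalized: "mat_inv (D_part A) * A = ?B"
    by (rule mat_inv_diag[OF assms(2) diag])
  have "mat_inv (D_part A) * A \<in> L_class n \<phi> \<longleftrightarrow> (\<exists>\<psi>. phase_aligned n ?B \<phi> \<psi>)" for \<phi>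
    unfolding normalized using diag n by (intro L_class_iff_phase_aligned) auto
  \<comment> \<open>An alignment for \<open>\<phi>\<close> yields the eigenvalue
    \<open>cis \<phi>\<close> of modulus 1; an eigenvalue \<open>\<mu>\<close> of modulus at least 1
    yields an alignment for \<open>Arg \<mu>\<close>.\<close>
  moreover have "spectral_radius (H_BGS A) < 1 \<longleftrightarrow> \<not> (\<exists>\<phi> \<psi>. phase_aligned n ?B \<phi> \<psi>)"
    unfolding spectral_radius_less_1_iff[OF H n(2)]
  proof
    assume less: "\<forall>\<mu>. eigenvalue (H_BGS A) \<mu> \<longrightarrow> cmod \<mu> < 1"
    have "\<not> phase_aligned n ?B \<phi> \<psi>" for \<phi> \<psi>
      using phase_aligned_imp_H_BGS_eigenvalue[OF assms(4) diag n(2), of \<phi> \<psi>]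
        less[rule_format, of "cis \<phi>"] by auto
    then show "\<not> (\<exists>\<phi> \<psi>. phase_aligned n ?B \<phi> \<psi>)" by blast
  next
    assume "\<not> (\<exists>\<phi> \<psi>. phase_aligned n ?B \<phi> \<psi>)"
    then show "\<forall>\<mu>. eigenvalue (H_BGS A) \<mu> \<longrightarrow> cmod \<mu> < 1"
      using H_BGS_eigenvalue_imp_phase_aligned[OF assms(3,4) n(1)] by (meson not_less)
  qed
  ultimately show ?thesis
    using spectral_radius_less_1_iff_BGS_converges[OF assms(2) diag n(2)] by blast
qed

end
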